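(* Let $n,s$ be nonnegative integers such that $n\equiv 2\pmod 3$ and $s\leq (n-2)/3$. Then $$\sum_{k=s}^{(n+1)/3+s}[6k-1]\frac{(q^{-1};q^3)_{k-s}(q^{-1};q^3)_{k+s}(q^{-1};q^3)_{k}}{(q^{3};q^3)_{k-s}(q^{3};q^3)_{k+s}(q^{3};q^3)_{k}}q^{3k}\equiv 0\pmod{\Phi_n(q)^3}.$$
   Context: Here $q$ is an indeterminate. For a nonnegative integer $m$, $(x;q^3)_m=\prod_{j=0}^{m-1}(1-xq^{3j})$ (with $(x;q^3)_0=1$). For an integer $r$ (possibly negative), $[r]=(1-q^r)/(1-q)$ is the $q$-integer. $\Phi_n(q)=\prod_{1\le k\le n,\ \gcd(k,n)=1}(q-\zeta^k)$, with $\zeta$ a primitive $n$-th root of unity, is the $n$-th cyclotomic polynomial in $q$. Congruences are between rational functions of $q$: for a rational function $A(q)\in\mathbb{Q}(q)$ and a polynomial $P(q)$, $A(q)\equiv 0\pmod{P(q)}$ means that $A(q)=P(q)N(q)/D(q)$ with $N,D\in\mathbb{Q}[q]$ and $D$ relatively prime to $P$. *)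

theory Defs
  imports
    Complex_Main
    "HOL-Computational_Algebra.Computational_Algebra"
    "HOL-Number_Theory.Totient"
begin

section \<open>Rational functions of \<open>q\<close>\<close>

text \<open>The field \<open>\<rat>(q)\<close> is \<^typ>\<open>rat poly fract\<close>; \<open>qvar\<close> is the indeterminate \<open>q\<close>.\<close>

definition qvar :: "rat poly fract" where
  "qvar = to_fract [:0, 1:]"

definition qint :: "int \<Rightarrow> rat poly fract" where
  "qint r = (1 - qvar powi r) / (1 - qvar)"

text \<open>\<open>qpoch x p m\<close> is the shifted factorial \<open>(x; p)\<^sub>m\<close> with base \<open>p\<close>.\<close>

definition qpoch :: "rat poly fract \<Rightarrow> rat poly fract \<Rightarrow> nat \<Rightarrow> rat poly fract" where
  "qpoch x p m = (\<Prod>j<m. 1 - x * p ^ j)"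

text \<open>
  The condition \<open>D \<noteq> 0\<close> says that \<open>N / D\<close> is a genuine fraction; it follows from
  coprimality unless \<open>P\<close> is a unit.
\<close>

definition cong_zero_mod :: "rat poly fract \<Rightarrow> rat poly \<Rightarrow> bool" where
  "cong_zero_mod A P \<longleftrightarrow>
     (\<exists>N D. D \<noteq> 0 \<and> coprime D P \<and> A = to_fract P * (to_fract N / to_fract D))"


section \<open>Cyclotomic polynomials\<close>

definition cyclotomic_complex :: "nat \<Rightarrow> complex poly" where
  "cyclotomic_complex n =
     (\<Prod>k | 1 \<le> k \<and> k \<le> n \<and> gcd k n = 1. [:- (cis (2 * pi / real n) ^ k), 1:])"

text \<open>
  \<open>cyclotomic n\<close> is the product above regarded as an element of \<open>\<rat>[q]\<close>.
  The lemma \<open>map_poly_cyclotomic\<close> below shows that it is well defined.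
\<close>

definition cyclotomic :: "nat \<Rightarrow> rat poly" where
  "cyclotomic n = (THE P. map_poly of_rat P = cyclotomic_complex n)"

context
begin

private abbreviation emb :: "rat poly \<Rightarrow> complex poly" where
  "emb \<equiv> map_poly of_rat"

private lemma coeff_emb: "coeff (emb p) i = of_rat (coeff p i)"
  by (simp add: coeff_map_poly)

private lemma emb_diff: "emb (p - r) = emb p - emb r"
  by (intro poly_eqI) (simp add: coeff_emb of_rat_diff)

private lemma emb_add: "emb (p + r) = emb p + emb r"
  by (intro poly_eqI) (simp add: coeff_emb of_rat_add)

private lemma emb_mult: "emb (p * r) = emb p * emb r"
  by (intro poly_eqI) (simp add: coeff_emb coeff_mult of_rat_sum of_rat_mult)

private lemma emb_prod: "emb (prod f A) = (\<Prod>x\<in>A. emb (f x))"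
  by (induction A rule: infinite_finite_induct) (simp_all add: emb_mult)

private lemma degree_emb: "degree (emb p) = degree p"
  by (rule degree_map_poly) simp

private lemma emb_inj: "emb p = emb r \<longleftrightarrow> p = r"
  by (auto simp: poly_eq_iff coeff_emb)

private lemma cyclotomic_complex_altdef:
  "cyclotomic_complex n = (\<Prod>k\<in>totatives n. [:- cis (2 * pi * real k / real n), 1:])"
  unfolding cyclotomic_complex_def
proof (rule prod.cong)
  show "{k. 1 \<le> k \<and> k \<le> n \<and> gcd k n = 1} = totatives n"
    by (auto simp: totatives_def coprime_iff_gcd_eq_1)
qed (simp add: DeMoivre mult_ac)

private lemma prod_roots_of_unity:
  assumes n: "n > 0"
  shows "(\<Prod>k\<in>{0<..n}. [:- cis (2 * pi * real k / real n), 1:]) = monom 1 n - 1"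
proof -
  let ?f = "\<lambda>k::nat. cis (2 * pi * real k / real n)"
  let ?Z = "{z::complex. z ^ n = 1}"
  have "(\<Prod>k\<in>{0<..n}. [:- ?f k, 1:]) = (\<Prod>k<n. [:- ?f k, 1:])"
    by (rule prod.reindex_bij_witness[of _ "\<lambda>k. if k = 0 then n else k" "\<lambda>k. if k = n then 0 else k"])
       (use n in auto)
  also have "\<dots> = (\<Prod>z\<in>?Z. [:- z, 1:])"
    by (rule prod.reindex_bij_betw[OF bij_betw_roots_unity[OF n]])
  also have "\<dots> = monom 1 n - 1"
  proof (rule poly_eqI_degree_lead_coeff[where A = ?Z and n = n])
    have "degree (\<Prod>z\<in>?Z. [:- z, 1:]) = n"
      by (subst degree_prod_eq_sum_degree) (simp_all add: card_roots_unity_eq n)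
    moreover have "lead_coeff (\<Prod>z\<in>?Z. [:- z, 1:]) = 1"
      by (simp add: lead_coeff_prod)
    ultimately show "degree (\<Prod>z\<in>?Z. [:- z, 1:]) \<le> n"
      and "coeff (\<Prod>z\<in>?Z. [:- z, 1:]) n = coeff (monom 1 n - 1) n"
      using n by (auto simp: one_pCons coeff_pCons split: nat.splits)
    show "degree (monom 1 n - 1 :: complex poly) \<le> n"
      by (intro degree_diff_le) (auto simp: degree_monom_le)
    show "n \<le> card ?Z" using n by (simp add: card_roots_unity_eq)
    fix z assume "z \<in> ?Z"
    thus "poly (\<Prod>z\<in>?Z. [:- z, 1:]) z = poly (monom 1 n - 1) z"
      using n by (auto simp: poly_prod poly_monom finite_roots_unity prod_zero_iff)
  qed
  finally show ?thesis .
qed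

private lemma prod_cyclotomic_complex:
  assumes n: "n > 0"
  shows "(\<Prod>d | d dvd n. cyclotomic_complex d) = monom 1 n - 1"
proof -
  let ?g = "\<lambda>k n. [:- cis (2 * pi * real k / real n), 1:]"
  define A where "A = (\<lambda>d. {k\<in>{0<..n}. gcd k n = d})"
  have *: "(\<Prod>k\<in>A d. ?g k n) = cyclotomic_complex (n div d)" if d: "d dvd n" for d
  proof -
    have "(\<Prod>k\<in>A d. ?g k n) = (\<Prod>k\<in>totatives (n div d). ?g (k * d) n)"
      unfolding A_def
      by (rule prod.reindex_bij_betw[symmetric, OF bij_betw_totatives_gcd_eq[OF d n]])
    also have "\<dots> = (\<Prod>k\<in>totatives (n div d). ?g k (n div d))"
      using d n by (intro prod.cong refl) (auto elim!: dvdE simp: mult.assoc)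
    finally show ?thesis by (simp add: cyclotomic_complex_altdef)
  qed
  have "monom 1 n - 1 = (\<Prod>k\<in>{0<..n}. ?g k n)"
    using prod_roots_of_unity[OF n] by simp
  also have "{0<..n} = (\<Union>d\<in>{d. d dvd n}. A d)" by (auto simp: A_def)
  also have "(\<Prod>k\<in>\<dots>. ?g k n) = (\<Prod>d | d dvd n. \<Prod>k\<in>A d. ?g k n)"
    using n by (intro prod.UNION_disjoint) (auto simp: A_def)
  also have "\<dots> = (\<Prod>d | d dvd n. cyclotomic_complex (n div d))"
    by (intro prod.cong refl *) auto
  also have "\<dots> = (\<Prod>d | d dvd n. cyclotomic_complex d)" using n
    by (intro prod.reindex_bij_witness[of _ "(div) n" "(div) n"]) (auto elim: dvdE)
  finally show ?thesis ..
qed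

private lemma lead_coeff_cyclotomic_complex: "lead_coeff (cyclotomic_complex n) = 1"
  by (simp add: cyclotomic_complex_def lead_coeff_prod)

private lemma cyclotomic_complex_rational: "\<exists>P. emb P = cyclotomic_complex n"
proof (induction n rule: less_induct)
  case (less n)
  show ?case
  proof (cases "n = 0")
    case True
    thus ?thesis by (intro exI[of _ 1]) (simp add: cyclotomic_complex_altdef)
  next
    case False
    hence n: "n > 0" by simp
    obtain P where P: "\<And>d. d < n \<Longrightarrow> emb (P d) = cyclotomic_complex d"
      using less.IH by metis
    define S where "S = {d. d dvd n} - {n}"
    have S: "d < n" if "d \<in> S" for d
      using that n by (auto simp: S_def intro: le_neq_implies_less dvd_imp_le)
    define Q where "Q = (\<Prod>d\<in>S. P d)"
    define R :: "rat poly" where "R = monom 1 n - 1"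
    have embQ: "emb Q = (\<Prod>d\<in>S. cyclotomic_complex d)"
      unfolding Q_def emb_prod using P S by (intro prod.cong) auto
    have "lead_coeff (emb Q) = 1"
      unfolding embQ lead_coeff_prod by (simp add: lead_coeff_cyclotomic_complex)
    hence Q0: "emb Q \<noteq> 0" by auto
    have "(\<Prod>d | d dvd n. cyclotomic_complex d) = cyclotomic_complex n * emb Q"
      unfolding embQ S_def using n by (subst prod.remove[of _ n]) auto
    hence eq: "cyclotomic_complex n * emb Q = emb R"
      using prod_cyclotomic_complex[OF n]
      by (simp add: R_def emb_diff map_poly_monom)
    have "emb R = emb (R div Q) * emb Q + emb (R mod Q)"
      unfolding emb_mult[symmetric] emb_add[symmetric] by simp
    with eq have eq': "(cyclotomic_complex n - emb (R div Q)) * emb Q = emb (R mod Q)"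
      by (simp add: algebra_simps)
    have "cyclotomic_complex n - emb (R div Q) = 0"
    proof (rule ccontr)
      assume nz: "cyclotomic_complex n - emb (R div Q) \<noteq> 0"
      from nz Q0 eq' have "R mod Q \<noteq> 0" by auto
      moreover have "Q \<noteq> 0" using Q0 by auto
      ultimately have "degree (R mod Q) < degree Q"
        using degree_mod_less by blast
      moreover have "degree (R mod Q) \<ge> degree Q"
        using degree_mult_eq[OF nz Q0] unfolding eq' degree_emb by simp
      ultimately show False by simp
    qed
    thus ?thesis by (intro exI[of _ "R div Q"]) simp
  qed
qed

lemma map_poly_cyclotomic: "map_poly of_rat (cyclotomic n) = cyclotomic_complex n"
proof -
  have "\<exists>!P. emb P = cyclotomic_complex n"
    using cyclotomic_complex_rational[of n] emb_inj by metis
  thus ?thesis unfolding cyclotomic_def by (rule theI')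
qed

end

end

theory Submission
  imports Defs "HOL-Library.Real_Mod" "HOL-Computational_Algebra.Field_as_Ring"
begin

text \<open>
  With base \<open>q\<^sup>3\<close> and \<open>k = s + j\<close>, the summand is that of a very-well-poised
  \<open>\<^sub>6\<phi>\<^sub>5\<close> series with \<open>a = q\<^bsup>6s-1\<^esup>\<close>, \<open>b = q\<^sup>-\<^sup>1\<close>, \<open>c = q\<^bsup>3s-1\<^esup>\<close>, \<open>d = q\<^bsup>3s+1\<^esup>\<close>,
  where the factors of \<open>d\<close> cancel since \<open>d\<^sup>2 = a q\<^sup>3\<close>. As \<open>a = b c d\<close>, its partial sums
  have a closed form. For the upper limit \<open>M + s\<close> with \<open>n = 3 M - 1\<close>, the closed form contains
  \<open>(q\<^sup>-\<^sup>1; q\<^sup>3)\<^sub>m\<close> for \<open>m = M + 1, M + s + 1, M + 2s + 1\<close>. Each of these three has the factor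
  \<open>1 - q\<^sup>n\<close>, while all denominators are prime to \<open>\<Phi>\<^sub>n\<close>.
\<close>

section \<open>The cyclotomic polynomial\<close>

lemma map_poly_of_rat_mult:
  "map_poly of_rat (p * r) = map_poly of_rat p * (map_poly of_rat r :: 'a::field_char_0 poly)"
  by (intro poly_eqI) (simp add: coeff_map_poly coeff_mult of_rat_sum of_rat_mult)

lemma map_poly_of_rat_add:
  "map_poly of_rat (p + r) = map_poly of_rat p + (map_poly of_rat r :: 'a::field_char_0 poly)"
  by (intro poly_eqI) (simp add: coeff_map_poly of_rat_add)

lemma map_poly_of_rat_diff:
  "map_poly of_rat (p - r) = map_poly of_rat p - (map_poly of_rat r :: 'a::field_char_0 poly)"
  by (intro poly_eqI) (simp add: coeff_map_poly of_rat_diff)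

text \<open>Division with remainder commutes with the embedding. The embedded divisor therefore
  divides the embedded remainder, whose degree is too small unless it vanishes.\<close>

lemma map_poly_of_rat_dvdD:
  assumes "map_poly of_rat p dvd (map_poly of_rat r :: 'a::field_char_0 poly)"
  shows "p dvd r"
proof (cases "p = 0")
  case True
  with assms show ?thesis by (simp add: map_poly_eq_0_iff)
next
  case False
  let ?e = "map_poly of_rat :: rat poly \<Rightarrow> 'a poly"
  have "?e r = ?e p * ?e (r div p) + ?e (r mod p)"
    unfolding map_poly_of_rat_mult[symmetric] map_poly_of_rat_add[symmetric] by simp
  with assms have dvd: "?e p dvd ?e (r mod p)"
    by (simp add: dvd_add_right_iff)
  have deg: "degree (?e x) = degree x" for x
    by (rule degree_map_poly) simp
  have "r mod p = 0"
  proof (rule ccontr)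
    assume nz: "r mod p \<noteq> 0"
    hence "?e (r mod p) \<noteq> 0" by (simp add: map_poly_eq_0_iff)
    from dvd_imp_degree_le[OF dvd this] have "degree p \<le> degree (r mod p)"
      by (simp add: deg)
    with degree_mod_less[OF False, of r] nz show False by simp
  qed
  thus ?thesis by auto
qed

text \<open>A common divisor has no complex root, so by the fundamental theorem of algebra it is a
  nonzero constant.\<close>

lemma coprime_poly_rat_if_no_common_root:
  fixes p r :: "rat poly"
  assumes "\<And>z::complex. poly (map_poly of_rat p) z = 0 \<Longrightarrow> poly (map_poly of_rat r) z \<noteq> 0"
  shows "coprime p r"
proof (rule coprimeI)
  fix d assume d: "d dvd p" "d dvd r"
  let ?e = "map_poly of_rat :: rat poly \<Rightarrow> complex poly"
  have no_root: "poly (?e d) z \<noteq> 0" for z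
    using d assms[of z] by (auto simp: map_poly_of_rat_mult elim!: dvdE)
  hence "degree (?e d) = 0"
    using fundamental_theorem_of_algebra[of "?e d"] by (auto simp: constant_degree)
  moreover have "degree (?e d) = degree d"
    by (rule degree_map_poly) simp
  moreover have "d \<noteq> 0"
    using no_root[of 0] by auto
  ultimately show "is_unit d"
    by (simp add: is_unit_iff_degree)
qed

text \<open>Each new linear factor is prime and does not divide the product of the others, because
  the roots are distinct. Coprime divisors can be multiplied.\<close>

lemma prod_linear_dvd:
  fixes p :: "'a::field_gcd poly"
  assumes "finite A" and "inj_on f A" and "\<And>x. x \<in> A \<Longrightarrow> poly p (f x) = 0"
  shows "(\<Prod>x\<in>A. [:- f x, 1:]) dvd p"
  using assms
proof (induction A rule: finite_induct)
  case (insert x A)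
  have "poly (\<Prod>y\<in>A. [:- f y, 1:]) (f x) \<noteq> 0"
    using insert by (auto simp: poly_prod)
  hence "coprime [:- f x, 1:] (\<Prod>y\<in>A. [:- f y, 1:])"
    by (simp add: prime_elem_imp_coprime prime_elem_linear_field_poly poly_eq_0_iff_dvd)
  thus ?case
    using insert by (simp add: divides_mult poly_eq_0_iff_dvd del: mult_pCons_left)
qed simp

section \<open>Roots of the cyclotomic polynomial\<close>

lemma map_poly_cyclotomic_totatives:
  "map_poly of_rat (cyclotomic n) = (\<Prod>k\<in>totatives n. [:- cis (2 * pi * real k / real n), 1:])"
  unfolding map_poly_cyclotomic cyclotomic_complex_def
proof (rule prod.cong)
  show "{k. 1 \<le> k \<and> k \<le> n \<and> gcd k n = 1} = totatives n"
    by (auto simp: totatives_def coprime_iff_gcd_eq_1)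
qed (simp add: DeMoivre mult_ac)

lemma poly_cyclotomic_eq_0_iff:
  "poly (map_poly of_rat (cyclotomic n)) z = 0 \<longleftrightarrow>
     (\<exists>k\<in>totatives n. z = cis (2 * pi * real k / real n))"
  by (auto simp: map_poly_cyclotomic_totatives poly_prod)

lemma cis_power_eq_1_iff:
  assumes "n > 0" and "coprime k n"
  shows "cis (2 * pi * real k / real n) ^ j = 1 \<longleftrightarrow> n dvd j"
proof
  assume "cis (2 * pi * real k / real n) ^ j = 1"
  then obtain m :: int where "real j * (2 * pi * real k / real n) = of_int m * (2 * pi)"
    by (auto simp: DeMoivre cis_eq_1_iff)
  hence "real j * real k = of_int m * real n"
    using assms by (simp add: field_simps)
  hence "real_of_int (int j * int k) = real_of_int (m * int n)"
    by simp
  hence "int j * int k = m * int n"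
    by (simp only: of_int_eq_iff)
  hence "int n dvd int (j * k)"
    by simp
  hence "n dvd j * k"
    by (simp only: int_dvd_int_iff)
  thus "n dvd j"
    using assms(2) by (simp add: coprime_dvd_mult_left_iff coprime_commute)
next
  assume "n dvd j"
  then obtain m where m: "j = n * m" by auto
  have "cis (2 * pi * real k / real n) ^ j = cis (2 * pi * real (m * k))"
    using assms(1) by (simp add: DeMoivre m field_simps)
  also have "\<dots> = 1"
    by (rule cis_multiple_2pi) simp
  finally show "cis (2 * pi * real k / real n) ^ j = 1" .
qed

lemma poly_of_rat_one_minus_monom:
  "poly (map_poly of_rat (1 - monom 1 j)) (z :: complex) = 1 - z ^ j"
  by (simp add: map_poly_of_rat_diff map_poly_monom poly_monom)

text \<open>The complex roots of \<open>cyclotomic n\<close> have multiplicative order exactly n, so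
  none of them is a root of 1 - q^j.\<close>

lemma coprime_one_minus_monom_cyclotomic:
  assumes "n > 0" and "\<not> n dvd j"
  shows "coprime (1 - monom 1 j) (cyclotomic n)"
proof -
  have "coprime (cyclotomic n) (1 - monom 1 j)"
    by (rule coprime_poly_rat_if_no_common_root)
       (use assms in \<open>auto simp: poly_cyclotomic_eq_0_iff poly_of_rat_one_minus_monom totatives_def
          cis_power_eq_1_iff eq_commute[of 1]\<close>)
  thus ?thesis by (simp add: coprime_commute)
qed

lemma coprime_X_cyclotomic: "coprime [:0, 1:] (cyclotomic n)"
proof -
  have "coprime (cyclotomic n) [:0, 1:]"
    by (rule coprime_poly_rat_if_no_common_root)
       (auto simp: poly_cyclotomic_eq_0_iff map_poly_pCons)
  thus ?thesis by (simp add: coprime_commute)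
qed

text \<open>Over the complex numbers the cyclotomic polynomial splits into distinct linear factors
  whose roots are n-th roots of unity. The divisibility found there descends to the
  rationals.\<close>

lemma cyclotomic_dvd:
  assumes "n > 0"
  shows "cyclotomic n dvd 1 - monom 1 n"
proof -
  let ?f = "\<lambda>k::nat. cis (2 * pi * real k / real n)"
  have "inj_on ?f (totatives n)"
  proof (rule inj_onI)
    fix k l assume kl: "k \<in> totatives n" "l \<in> totatives n" "?f k = ?f l"
    then obtain m :: int where "2 * pi * real k / real n = 2 * pi * real l / real n + of_int m * (2 * pi)"
      using cis_eq_1_iff[of "2 * pi * real k / real n - 2 * pi * real l / real n"]
      by (auto simp: algebra_simps simp flip: cis_divide)
    hence "2 * pi * real k = 2 * pi * (real l + of_int m * real n)"
      using assms by (simp add: field_simps)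
    hence "real k = real l + of_int m * real n"
      by simp
    hence "real_of_int (int k) = real_of_int (int l + m * int n)"
      by simp
    hence "int k = int l + m * int n"
      by (simp only: of_int_eq_iff)
    hence "int k mod int n = int l mod int n"
      by simp
    hence "k mod n = l mod n"
      by (simp flip: of_nat_mod)
    \<comment> \<open>Totatives lie in 1..n, so residues determine them; the cases treat n itself,
      which has residue 0.\<close>
    with kl show "k = l"
      by (cases "k = n"; cases "l = n") (auto simp: totatives_def)
  qed
  moreover have "poly (map_poly of_rat (1 - monom 1 n)) (?f k) = 0" if "k \<in> totatives n" for k
    using that assms by (simp add: poly_of_rat_one_minus_monom cis_power_eq_1_iff totatives_def)
  ultimately have "(\<Prod>k\<in>totatives n. [:- ?f k, 1:]) dvd map_poly of_rat (1 - monom 1 n)"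
    by (intro prod_linear_dvd) auto
  also have "(\<Prod>k\<in>totatives n. [:- ?f k, 1:]) = map_poly of_rat (cyclotomic n)"
    by (simp only: map_poly_cyclotomic_totatives)
  finally show ?thesis
    by (rule map_poly_of_rat_dvdD)
qed

section \<open>Rational functions without pole at a polynomial\<close>

text \<open>These fractions form the localization of the polynomial ring at the denominators prime
  to P. A congruence to 0 mod P is membership in P times this ring.\<close>

definition regular_at :: "rat poly \<Rightarrow> rat poly fract \<Rightarrow> bool" where
  "regular_at P A \<longleftrightarrow> (\<exists>N D. D \<noteq> 0 \<and> coprime D P \<and> A = to_fract N / to_fract D)"

lemma regular_at_to_fract: "regular_at P (to_fract N)"
  unfolding regular_at_def by (intro exI[of _ N] exI[of _ 1]) auto

lemma regular_at_one: "regular_at P 1"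
  using regular_at_to_fract[of P 1] by simp

lemma regular_at_mult:
  assumes "regular_at P A" and "regular_at P B"
  shows "regular_at P (A * B)"
proof -
  obtain N D N' D' where "D \<noteq> 0" "coprime D P" "A = to_fract N / to_fract D"
    "D' \<noteq> 0" "coprime D' P" "B = to_fract N' / to_fract D'"
    using assms unfolding regular_at_def by blast
  hence "D * D' \<noteq> 0 \<and> coprime (D * D') P \<and> A * B = to_fract (N * N') / to_fract (D * D')"
    by simp
  thus ?thesis
    unfolding regular_at_def by blast
qed

lemma regular_at_prod:
  "(\<And>x. x \<in> S \<Longrightarrow> regular_at P (f x)) \<Longrightarrow> regular_at P (prod f S)"
  by (induction S rule: infinite_finite_induct) (auto intro: regular_at_mult regular_at_one)

lemma regular_at_inverse_to_fract: "D \<noteq> 0 \<Longrightarrow> coprime D P \<Longrightarrow> regular_at P (inverse (to_fract D))"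
  unfolding regular_at_def by (intro exI[of _ 1] exI[of _ D]) (simp add: divide_inverse)

lemma cong_zero_mod_power:
  assumes "regular_at P A"
  shows "cong_zero_mod (to_fract P ^ m * A) (P ^ m)"
proof -
  have "to_fract (P ^ m) = to_fract P ^ m"
    by (induction m) auto
  moreover obtain N D where "D \<noteq> 0" "coprime D P" "A = to_fract N / to_fract D"
    using assms unfolding regular_at_def by blast
  moreover have "coprime D (P ^ m)"
    using \<open>coprime D P\<close> by simp
  ultimately show ?thesis
    unfolding cong_zero_mod_def by metis
qed

section \<open>Powers of q, and poles of expressions in them\<close>

lemma qvar_nonzero: "qvar \<noteq> 0"
  by (simp add: qvar_def)

lemma one_minus_qvar_power: "1 - qvar ^ j = to_fract (1 - monom 1 j)"
proof -
  have "qvar ^ j = to_fract (monom 1 j)"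
    by (induction j) (simp_all add: qvar_def monom_Suc flip: to_fract_mult)
  thus ?thesis by simp
qed

lemma qvar_power_neq_1: "j > 0 \<Longrightarrow> qvar ^ j \<noteq> 1"
proof -
  assume "j > 0"
  hence "(1 - monom 1 j :: rat poly) \<noteq> 0"
    by (auto simp: poly_eq_iff dest!: spec[of _ j])
  thus ?thesis
    using one_minus_qvar_power[of j] by (metis right_minus_eq to_fract_eq_0_iff)
qed

lemma qvar_power_neq: "i \<noteq> j \<Longrightarrow> qvar ^ i \<noteq> qvar ^ j"
proof (induction i j rule: linorder_wlog)
  case (le i j)
  then obtain d where d: "j = i + d" "d > 0"
    by (metis le_neq_implies_less less_imp_add_positive)
  thus ?case
    using qvar_power_neq_1[of d] by (simp add: power_add qvar_nonzero)
next
  case (sym i j)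
  thus ?case by metis
qed

lemma regular_at_qvar_power: "regular_at P (qvar ^ j)"
proof -
  have "qvar ^ j = to_fract ([:0, 1:] ^ j)"
    by (induction j) (simp_all add: qvar_def flip: to_fract_mult)
  thus ?thesis by (simp add: regular_at_to_fract)
qed

lemma regular_at_one_minus_qvar_power: "regular_at P (1 - qvar ^ j)"
  by (simp only: one_minus_qvar_power regular_at_to_fract)

lemma regular_at_inverse_one_minus_qvar_power:
  assumes "n > 0" and "\<not> n dvd j"
  shows "regular_at (cyclotomic n) (inverse (1 - qvar ^ j))"
proof -
  have "j > 0" using assms by (cases j) auto
  hence "1 - qvar ^ j \<noteq> 0" using qvar_power_neq_1[of j] by simp
  thus ?thesis
    unfolding one_minus_qvar_power
    by (intro regular_at_inverse_to_fract coprime_one_minus_monom_cyclotomic assms) auto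
qed

lemma regular_at_inverse_qvar: "regular_at (cyclotomic n) (inverse qvar)"
  unfolding qvar_def by (intro regular_at_inverse_to_fract coprime_X_cyclotomic) auto

lemma regular_at_minus: "regular_at P A \<Longrightarrow> regular_at P (- A)"
  using regular_at_mult[OF regular_at_to_fract[of P "- 1"], of A] by simp

text \<open>Treats the first factor of the factorial with argument 1/q, the only one in which the
  exponent of q is negative.\<close>

lemma one_minus_inverse_qvar: "1 - inverse qvar = - (inverse qvar * (1 - qvar))"
  by (simp add: algebra_simps qvar_nonzero)

lemma one_minus_qvar_power_div_qvar:
  "j > 0 \<Longrightarrow> 1 - inverse qvar * qvar ^ j = 1 - qvar ^ (j - 1)"
  by (cases j) (simp_all add: qvar_nonzero)

section \<open>The shifted factorials\<close>

lemma qpoch_Suc: "qpoch x p (Suc m) = qpoch x p m * (1 - x * p ^ m)"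
  by (simp add: qpoch_def)

lemma qpoch_qvar_nonzero: "qpoch (qvar ^ 3) (qvar ^ 3) m \<noteq> 0"
proof -
  have "qvar ^ 3 * (qvar ^ 3) ^ j \<noteq> 1" for j
    using qvar_power_neq_1[of "3 + 3 * j"] by (simp add: power_add power_mult)
  thus ?thesis by (auto simp: qpoch_def)
qed

text \<open>The factors are 1 - q^(3(j+1)) with 0 < j+1 < n. As 3 is invertible mod n, no exponent
  is a multiple of n.\<close>

lemma regular_at_inverse_qpoch:
  assumes "n > 0" and "m < n" and "coprime n 3"
  shows "regular_at (cyclotomic n) (inverse (qpoch (qvar ^ 3) (qvar ^ 3) m))"
proof -
  have "regular_at (cyclotomic n) (inverse (1 - qvar ^ 3 * (qvar ^ 3) ^ j))" if "j < m" for j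
  proof -
    have "\<not> n dvd Suc j"
      using that assms(2) by (auto dest: dvd_imp_le)
    hence "\<not> n dvd 3 * Suc j"
      using assms(3) by (simp add: coprime_dvd_mult_right_iff del: mult_Suc_right)
    hence "regular_at (cyclotomic n) (inverse (1 - qvar ^ (3 * Suc j)))"
      by (intro regular_at_inverse_one_minus_qvar_power assms)
    also have "qvar ^ (3 * Suc j) = qvar ^ 3 * (qvar ^ 3) ^ j"
      by (simp only: power_mult power_Suc)
    finally show ?thesis .
  qed
  thus ?thesis
    unfolding qpoch_def prod_inversef[symmetric] comp_def by (intro regular_at_prod) auto
qed

text \<open>The factor with index M is 1 - q^(3M-1) = 1 - q^n, and M < m ensures that it occurs. The
  other factors have no pole.\<close>

lemma qpoch_inverse_qvar_divisible:
  assumes "n > 0" and "n + 1 = 3 * M" and "M < m"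
  obtains A where "regular_at (cyclotomic n) A"
    and "qpoch (inverse qvar) (qvar ^ 3) m = to_fract (cyclotomic n) * A"
proof -
  let ?P = "cyclotomic n"
  let ?f = "\<lambda>j. 1 - inverse qvar * (qvar ^ 3) ^ j"
  have f: "?f j = 1 - qvar ^ (3 * j - 1)" if "j > 0" for j
    using that one_minus_qvar_power_div_qvar[of "3 * j"] by (simp add: power_mult)
  have f_regular: "regular_at ?P (?f j)" for j
  proof (cases "j = 0")
    case True
    have "regular_at ?P (- (inverse qvar * (1 - qvar ^ 1)))"
      by (intro regular_at_minus regular_at_mult regular_at_inverse_qvar
          regular_at_one_minus_qvar_power)
    thus ?thesis using True by (simp add: one_minus_inverse_qvar)
  next
    case False
    thus ?thesis using f[of j] regular_at_one_minus_qvar_power by simp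
  qed
  obtain R where R: "1 - monom 1 n = ?P * R"
    using cyclotomic_dvd[OF assms(1)] by (elim dvdE)
  have "3 * M - 1 = n" "M > 0" using assms by auto
  hence fM: "?f M = to_fract ?P * to_fract R"
    using f[of M] one_minus_qvar_power[of n] R by (simp flip: to_fract_mult)
  have "qpoch (inverse qvar) (qvar ^ 3) m = ?f M * prod ?f ({..<m} - {M})"
    unfolding qpoch_def using assms(3) by (intro prod.remove) auto
  also have "\<dots> = to_fract ?P * (to_fract R * prod ?f ({..<m} - {M}))"
    by (simp only: fM mult.assoc)
  finally show ?thesis
    by (rule that[rotated]) (intro regular_at_mult regular_at_to_fract regular_at_prod f_regular)
qed

section \<open>The closed form\<close>

text \<open>Splitting q^(6k-1) this way avoids subtraction of exponents and matches the shape
  z*z*y*y*i used for telescoping, where q^(3k) = z*y.\<close>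

lemma qint_conv: "qint (6 * int k - 1) = (1 - qvar ^ (3 * k) * qvar ^ (3 * k) * inverse qvar) / (1 - qvar)"
proof -
  have "qvar powi (6 * int k - 1) = qvar powi (int (6 * k)) / qvar"
    by (simp add: power_int_diff qvar_nonzero)
  also have "qvar powi (int (6 * k)) = qvar ^ (3 * k) * qvar ^ (3 * k)"
    by (simp only: power_int_of_nat flip: power_add) simp
  finally show ?thesis
    by (simp add: qint_def divide_inverse)
qed

text \<open>This is the induction step of the closed form with denominators and common factors
  removed: i = 1/q, y = q^(3s), z = q^(3(N+1)).\<close>

lemma telescoping_identity:
  fixes q i y z :: "'a::field"
  assumes "q * i = 1"
  shows "(1 - z*y*i*i) * (1 - z) * (1 - z*y) * (1 - z*y*y) +
         (1 - z*z*y*y*i) * z * ((1 - i) * (1 - y*i) * (1 - y*q)) =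
         (1 - z*i) * (1 - z*y*i) * (1 - z*y*y*i) * (1 - z*y*q)"
  using assms by algebra

text \<open>Here A, B, C stand for the numerator factorials and a, b, c for the denominator
  factorials of the closed form at N. All three terms share the factor \<open>?G\<close>, which
  reduces the claim to \<open>telescoping_identity\<close>.\<close>

lemma telescoping_step:
  fixes q i y z A B C a b c :: "'a::field"
  assumes "q * i = 1" and "a \<noteq> 0" "b \<noteq> 0" "c \<noteq> 0" and "1 - q \<noteq> 0"
    and "1 - z \<noteq> 0" "1 - z*y \<noteq> 0" "1 - z*y*y \<noteq> 0"
    and "(1 - i) * (1 - y*i) * (1 - y*q) \<noteq> 0"
  defines "E \<equiv> (1 - i) * (1 - y*i) * (1 - y*q)"
  shows "y * A * B * C * (1 - z*y*i*i) / ((1 - q) * E * a * b * c) +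
         (1 - z*z*y*y*i) / (1 - q) *
           (A * B * C / ((a * (1 - z)) * (b * (1 - z*y*y)) * (c * (1 - z*y)))) * (z*y) =
         y * (A * (1 - z*i)) * (B * (1 - z*y*i)) * (C * (1 - z*y*y*i)) * (1 - z*y*q) /
           ((1 - q) * E * (a * (1 - z)) * (b * (1 - z*y*y)) * (c * (1 - z*y)))"
proof -
  let ?G = "y * A * B * C / ((1 - q) * E * (a * (1 - z)) * (b * (1 - z*y*y)) * (c * (1 - z*y)))"
  have E: "E \<noteq> 0" using assms by simp
  have old: "y * A * B * C * (1 - z*y*i*i) / ((1 - q) * E * a * b * c) =
      ?G * ((1 - z*y*i*i) * (1 - z) * (1 - z*y) * (1 - z*y*y))"
    using assms(2-8) E by (simp add: mult_ac)
  have summand: "(1 - z*z*y*y*i) / (1 - q) *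
       (A * B * C / ((a * (1 - z)) * (b * (1 - z*y*y)) * (c * (1 - z*y)))) * (z*y) =
      ?G * ((1 - z*z*y*y*i) * z * E)"
    using assms(2-8) E by (simp add: mult_ac)
  have new: "y * (A * (1 - z*i)) * (B * (1 - z*y*i)) * (C * (1 - z*y*y*i)) * (1 - z*y*q) /
       ((1 - q) * E * (a * (1 - z)) * (b * (1 - z*y*y)) * (c * (1 - z*y))) =
      ?G * ((1 - z*i) * (1 - z*y*i) * (1 - z*y*y*i) * (1 - z*y*q))"
    by simp
  show ?thesis
    unfolding old summand new distrib_left[symmetric]
    by (simp only: E_def telescoping_identity[OF assms(1)])
qed

lemma sum_closed_form:
  fixes s N :: nat
  defines "u \<equiv> qpoch (inverse qvar) (qvar ^ 3)" and "v \<equiv> qpoch (qvar ^ 3) (qvar ^ 3)"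
    and "E \<equiv> (1 - inverse qvar) * (1 - qvar ^ (3 * s) * inverse qvar) * (1 - qvar ^ (3 * s) * qvar)"
  shows "(\<Sum>k = s..N + s. qint (6 * int k - 1) *
            ((u (k - s) * u (k + s) * u k) / (v (k - s) * v (k + s) * v k)) * qvar ^ (3 * k)) =
         qvar ^ (3 * s) * u (N + 1) * u (N + s + 1) * u (N + 2 * s + 1) *
           (1 - qvar ^ (3 * (N + s)) * qvar) /
         ((1 - qvar) * E * v N * v (N + 2 * s) * v (N + s))"
proof -
  define y where "y = qvar ^ (3 * s)"
  define i where "i = inverse qvar"
  have qi: "qvar * i = 1" by (simp add: i_def qvar_nonzero)
  have v0: "v m \<noteq> 0" for m by (simp add: v_def qpoch_qvar_nonzero)
  have q1: "1 - qvar \<noteq> 0" using qvar_power_neq_1[of 1] by simp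
  \<comment> \<open>The exponent 3s is never 1.\<close>
  have "y \<noteq> qvar"
    unfolding y_def using qvar_power_neq[of "3 * s" 1] by fastforce
  hence "1 - y * i \<noteq> 0"
    by (simp add: i_def field_simps qvar_nonzero)
  moreover have "1 - y * qvar \<noteq> 0"
    using qvar_power_neq_1[of "3 * s + 1"] by (simp add: y_def mult.commute)
  moreover have "1 - i \<noteq> 0"
    using q1 by (simp add: i_def)
  ultimately have E0: "(1 - i) * (1 - y * i) * (1 - y * qvar) \<noteq> 0"
    by simp
  have E: "E = (1 - i) * (1 - y * i) * (1 - y * qvar)"
    by (simp add: E_def i_def y_def)
  have u_Suc: "u (Suc m) = u m * (1 - qvar ^ (3 * m) * i)" for m
    by (simp add: u_def qpoch_Suc i_def mult.commute flip: power_mult)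
  have v_Suc: "v (Suc m) = v m * (1 - qvar ^ (3 * Suc m))" for m
    by (simp only: v_def qpoch_Suc power_mult power_Suc)
  show ?thesis
  proof (induction N)
    \<comment> \<open>The factor \<open>E\<close> cancels against 1 - i and 1 - y*i, which come from
      \<open>u 1\<close> and \<open>u (s + 1)\<close>, and against 1 - y*q. What remains is the
      summand for k = s, with 1 - y*y*i from \<open>u (2 * s + 1)\<close> supplying its
      q-integer.\<close>
    case 0
    have "u 0 = 1" "v 0 = 1" by (simp_all add: u_def v_def qpoch_def)
    moreover have "u 1 = 1 - i" using u_Suc[of 0] \<open>u 0 = 1\<close> by simp
    moreover have "qvar ^ (3 * (2 * s)) = y * y"
      by (simp add: y_def flip: power_add)
    ultimately show ?case
      using E0 q1 v0[of s] v0[of "2 * s"]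
      by (simp add: E u_Suc qint_conv flip: y_def i_def mult_2)
  next
    case (Suc N)
    \<comment> \<open>The new index is k = N + 1 + s, so q^(3k) = z*y and q^(3(k+s)) =
      z*y*y.\<close>
    define z where "z = qvar ^ (3 * Suc N)"
    have pows: "qvar ^ (3 * Suc (N + s)) = z * y" "qvar ^ (3 * Suc (N + 2 * s)) = z * y * y"
      by (simp_all add: z_def y_def power_add power_mult mult_ac)
    have z0: "1 - z \<noteq> 0" "1 - z * y \<noteq> 0" "1 - z * y * y \<noteq> 0"
      using qvar_power_neq_1[of "3 * Suc N"] qvar_power_neq_1[of "3 * Suc (N + s)"]
        qvar_power_neq_1[of "3 * Suc (N + 2 * s)"]
      unfolding pows z_def[symmetric] by auto
    have "z * y = qvar * qvar * qvar * qvar ^ (3 * (N + s))"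
      by (simp only: pows(1)[symmetric]) (simp add: power_add power3_eq_cube mult_ac)
    hence old: "qvar ^ (3 * (N + s)) * qvar = z * y * i * i"
      by (simp add: i_def qvar_nonzero field_simps)
    have idx: "Suc N + s = Suc (N + s)" "Suc N + 2 * s = Suc (N + 2 * s)"
      "Suc (N + s) - s = Suc N" "Suc (N + s) + s = Suc (N + 2 * s)"
      by simp_all
    have new_u: "u (Suc N + 1) = u (N + 1) * (1 - z * i)"
      "u (Suc (N + s) + 1) = u (N + s + 1) * (1 - z * y * i)"
      "u (Suc (N + 2 * s) + 1) = u (N + 2 * s + 1) * (1 - z * y * y * i)"
      by (simp_all only: Suc_eq_plus1[symmetric] u_Suc pows) (simp_all add: z_def)
    have new_v: "v (Suc N) = v N * (1 - z)" "v (Suc (N + s)) = v (N + s) * (1 - z * y)"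
      "v (Suc (N + 2 * s)) = v (N + 2 * s) * (1 - z * y * y)"
      by (simp_all only: v_Suc pows) (simp_all add: z_def)
    let ?t = "\<lambda>k. qint (6 * int k - 1) *
      ((u (k - s) * u (k + s) * u k) / (v (k - s) * v (k + s) * v k)) * qvar ^ (3 * k)"
    have t: "?t (Suc (N + s)) = (1 - z*z*y*y*i) / (1 - qvar) *
        (u (N + 1) * u (N + s + 1) * u (N + 2 * s + 1) /
          ((v N * (1 - z)) * (v (N + 2 * s) * (1 - z*y*y)) * (v (N + s) * (1 - z*y)))) * (z*y)"
      unfolding idx qint_conv pows new_v i_def[symmetric] by (simp only: Suc_eq_plus1 mult_ac)
    have "sum ?t {s..Suc N + s} = sum ?t {s..N + s} + ?t (Suc (N + s))"
      unfolding idx(1) by (rule trans[OF sum.nat_ivl_Suc' add.commute]) simp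
    also have "\<dots> = y * u (N + 1) * u (N + s + 1) * u (N + 2 * s + 1) * (1 - z*y*i*i) /
        ((1 - qvar) * E * v N * v (N + 2 * s) * v (N + s)) + ?t (Suc (N + s))"
      by (simp only: Suc.IH old y_def[symmetric])
    also have "\<dots> = y * (u (N + 1) * (1 - z*i)) * (u (N + s + 1) * (1 - z*y*i)) *
        (u (N + 2 * s + 1) * (1 - z*y*y*i)) * (1 - z*y*qvar) /
        ((1 - qvar) * E * (v N * (1 - z)) * (v (N + 2 * s) * (1 - z*y*y)) * (v (N + s) * (1 - z*y)))"
      unfolding t E by (rule telescoping_step[OF qi v0 v0 v0 q1 z0 E0])
    finally show ?case
      unfolding idx new_u new_v pows y_def[symmetric] .
  qed
qed

theorem theorem1p1:
  fixes n s :: nat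
  assumes "n mod 3 = 2" and "s \<le> (n - 2) div 3"
  shows "cong_zero_mod
    (\<Sum>k = s..(n + 1) div 3 + s.
       qint (6 * int k - 1) *
       ((qpoch (inverse qvar) (qvar ^ 3) (k - s) *
         qpoch (inverse qvar) (qvar ^ 3) (k + s) *
         qpoch (inverse qvar) (qvar ^ 3) k) /
        (qpoch (qvar ^ 3) (qvar ^ 3) (k - s) *
         qpoch (qvar ^ 3) (qvar ^ 3) (k + s) *
         qpoch (qvar ^ 3) (qvar ^ 3) k)) *
       qvar ^ (3 * k))
    (cyclotomic n ^ 3)"
proof -
  define M where "M = (n + 1) div 3"
  let ?P = "cyclotomic n"
  let ?u = "qpoch (inverse qvar) (qvar ^ 3)" and ?v = "qpoch (qvar ^ 3) (qvar ^ 3)"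
  \<comment> \<open>Since n = 3M - 1, the bound (n-2)/3 on s is M - 1.\<close>
  have n: "n + 1 = 3 * M" "s < M" "n > 0"
    unfolding M_def using assms by presburger+
  have cop: "coprime n 3"
  proof -
    have "coprime 3 n"
      using assms(1) by (intro prime_imp_coprime) (auto simp: dvd_eq_mod_eq_0)
    thus ?thesis by (simp add: coprime_commute)
  qed
  obtain A B C where
    A: "regular_at ?P A" "?u (M + 1) = to_fract ?P * A" and
    B: "regular_at ?P B" "?u (M + s + 1) = to_fract ?P * B" and
    C: "regular_at ?P C" "?u (M + 2 * s + 1) = to_fract ?P * C"
    using qpoch_inverse_qvar_divisible[OF n(3,1), of "M + 1"]
      qpoch_inverse_qvar_divisible[OF n(3,1), of "M + s + 1"]
      qpoch_inverse_qvar_divisible[OF n(3,1), of "M + 2 * s + 1"] by auto metis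
  \<comment> \<open>The exponents needed below are 1, 3s - 1 (for s > 0) and 3s + 1; the largest is
    at most 3M - 2 = n - 1.\<close>
  have inv_power: "regular_at ?P (inverse (1 - qvar ^ j))" if "0 < j" "j < n" for j
    using that n(3) by (intro regular_at_inverse_one_minus_qvar_power) (auto dest: dvd_imp_le)
  have q1: "regular_at ?P (inverse (1 - qvar))"
    using inv_power[of 1] n by simp
  have E1: "regular_at ?P (inverse (1 - inverse qvar))"
    using regular_at_minus[OF regular_at_mult[OF regular_at_qvar_power[of _ 1] q1]]
    by (simp add: one_minus_inverse_qvar)
  \<comment> \<open>For s = 0 the exponent 3s - 1 is negative, and the factor is 1 - 1/q
    again.\<close>
  have E2: "regular_at ?P (inverse (1 - qvar ^ (3 * s) * inverse qvar))"
  proof (cases "s = 0")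
    case True
    thus ?thesis using E1 by simp
  next
    case False
    thus ?thesis
      using inv_power[of "3 * s - 1"] n one_minus_qvar_power_div_qvar[of "3 * s"]
      by (simp add: mult.commute)
  qed
  have E3: "regular_at ?P (inverse (1 - qvar ^ (3 * s) * qvar))"
    using inv_power[of "3 * s + 1"] n by (simp add: mult.commute)
  have V: "regular_at ?P (inverse (?v m))" if "m < n" for m
    by (rule regular_at_inverse_qpoch[OF n(3) that cop])
  have top: "regular_at ?P (1 - qvar ^ (3 * (M + s)) * qvar)"
    using regular_at_one_minus_qvar_power[of ?P "3 * (M + s) + 1"] by (simp add: mult.commute)
  \<comment> \<open>The cofactor left when one cyclotomic factor is taken from each of the three
    numerator factorials of the closed form.\<close>
  let ?R = "A * B * C * qvar ^ (3 * s) * (1 - qvar ^ (3 * (M + s)) * qvar) *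
    inverse (1 - qvar) * inverse (1 - inverse qvar) * inverse (1 - qvar ^ (3 * s) * inverse qvar) *
    inverse (1 - qvar ^ (3 * s) * qvar) * inverse (?v M) * inverse (?v (M + 2 * s)) *
    inverse (?v (M + s))"
  have "regular_at ?P ?R"
    \<comment> \<open>The denominator lengths stay below n: s <= M - 1 gives M + 2s <= 3M - 2 = n -
      1.\<close>
    using n by (intro regular_at_mult regular_at_qvar_power A B C top q1 E1 E2 E3 V) auto
  hence "cong_zero_mod (to_fract ?P ^ 3 * ?R) (?P ^ 3)"
    by (rule cong_zero_mod_power)
  thus ?thesis
    unfolding M_def[symmetric] sum_closed_form A B C
    by (simp add: divide_inverse power3_eq_cube mult_ac)
qed

end
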